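(* Let $n\geq 2$ be an integer. Then the folded hypercube $FQ_n$ of dimension $n$ is a symmetric graph.
   Context: Graphs are undirected. The hypercube $Q_n$ of dimension $n$ is the graph with vertex-set $\{(x_1,\dots,x_n) \mid x_i\in\{0,1\}\}$, in which two vertices $(x_1,\dots,x_n)$ and $(y_1,\dots,y_n)$ are adjacent if and only if $x_i=y_i$ for all but exactly one $i$. The folded hypercube $FQ_n$ is the graph obtained from $Q_n$ by adding an edge between every two vertices $(x_1,\dots,x_n)$ and $(\bar{x}_1,\dots,\bar{x}_n)$, where $\bar 1=0$ and $\bar 0=1$. A graph $\Gamma$ is called symmetric if for all vertices $u,v,x,y$ of $\Gamma$ such that $u$ and $v$ are adjacent and $x$ and $y$ are adjacent, there is an automorphism $\alpha$ of $\Gamma$ such that $\alpha(u)=x$ and $\alpha(v)=y$. *)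

theory Defs
  imports "Graph_Theory.Digraph_Isomorphism" "Graph_Theory.Pair_Digraph"
begin

text \<open>
  As in Graph_Theory, an undirected graph is a digraph whose arc relation is symmetric, so an
  edge \<open>{u, v}\<close> is the pair of arcs \<open>(u, v)\<close> and \<open>(v, u)\<close>.
  Vertices of the hypercube are Boolean lists of length \<open>n\<close>, with \<^const>\<open>False\<close>
  for 0 and \<^const>\<open>True\<close> for 1; coordinates are numbered from 0.
\<close>

definition hypercube :: "nat \<Rightarrow> bool list pair_pre_digraph" where
  "hypercube n = \<lparr> pverts = {x. length x = n},
     parcs = {(x, y). length x = n \<and> length y = n \<and> (\<exists>!i. i < n \<and> x ! i \<noteq> y ! i)} \<rparr>"

definition folded_hypercube :: "nat \<Rightarrow> bool list pair_pre_digraph" where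
  "folded_hypercube n = \<lparr> pverts = pverts (hypercube n),
     parcs = parcs (hypercube n) \<union> {(x, map Not x) | x. x \<in> pverts (hypercube n)} \<rparr>"

text \<open>
  Isomorphisms in Graph_Theory act on vertices and on arcs; \<open>\<alpha>\<close> is the vertex part.
  The lemma \<open>graph_automorphism_with_proj\<close> below gives the usual formulation for
  graphs without parallel arcs.
\<close>

definition graph_automorphism :: "('a, 'b) pre_digraph \<Rightarrow> ('a \<Rightarrow> 'a) \<Rightarrow> bool" where
  "graph_automorphism G \<alpha> \<longleftrightarrow>
     (\<exists>h. pre_digraph.digraph_isomorphism G h \<and> app_iso h G = G \<and> iso_verts h = \<alpha>)"

text \<open>
  Not to be confused with \<^const>\<open>symmetric\<close>, which only says that the arc relation is
  symmetric.
\<close>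

definition symmetric_graph :: "('a, 'b) pre_digraph \<Rightarrow> bool" where
  "symmetric_graph G \<longleftrightarrow>
     (\<forall>u\<in>verts G. \<forall>v\<in>verts G. \<forall>x\<in>verts G. \<forall>y\<in>verts G.
        (u, v) \<in> arcs_ends G \<longrightarrow> (x, y) \<in> arcs_ends G \<longrightarrow>
        (\<exists>\<alpha>. graph_automorphism G \<alpha> \<and> \<alpha> u = x \<and> \<alpha> v = y))"

lemma graph_automorphism_with_proj:
  assumes "pair_wf_digraph G"
  shows "graph_automorphism (with_proj G) \<alpha> \<longleftrightarrow>
    bij_betw \<alpha> (pverts G) (pverts G) \<and>
    (\<forall>u\<in>pverts G. \<forall>v\<in>pverts G. (u, v) \<in> parcs G \<longleftrightarrow> (\<alpha> u, \<alpha> v) \<in> parcs G)"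
    (is "?L \<longleftrightarrow> ?R")
proof
  interpret pair_wf_digraph G by fact
  have wf: "wf_digraph (with_proj G)" by unfold_locales
  {
    assume ?L
    then obtain h where iso: "pre_digraph.digraph_isomorphism (with_proj G) h"
      and app: "app_iso h (with_proj G) = with_proj G" and h: "iso_verts h = \<alpha>"
      unfolding graph_automorphism_def by blast
    have V: "\<alpha> ` pverts G = pverts G" and A: "iso_arcs h ` parcs G = parcs G"
      and t: "iso_tail h = fst" and hd: "iso_head h = snd"
      using app h by (auto simp: app_iso_def with_proj_def)
    have inj: "inj_on \<alpha> (pverts G)"
      using iso h by (auto simp: pre_digraph.digraph_isomorphism_def)
    have arc: "iso_arcs h (u, v) = (\<alpha> u, \<alpha> v)" if "(u, v) \<in> parcs G" for u v
    proof -
      have "\<alpha> u = fst (iso_arcs h (u, v)) \<and> \<alpha> v = snd (iso_arcs h (u, v))"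
        using iso that t hd h unfolding pre_digraph.digraph_isomorphism_def by fastforce
      then show ?thesis by (simp add: prod_eq_iff)
    qed
    have "(u, v) \<in> parcs G" if uv: "u \<in> pverts G" "v \<in> pverts G" "(\<alpha> u, \<alpha> v) \<in> parcs G" for u v
    proof -
      obtain u' v' where p: "(u', v') \<in> parcs G" "(\<alpha> u, \<alpha> v) = iso_arcs h (u', v')"
        using uv(3) A by (metis imageE surj_pair)
      then have "\<alpha> u = \<alpha> u'" "\<alpha> v = \<alpha> v'" using arc by auto
      then have "u = u'" "v = v'" using inj uv in_arcsD1[OF p(1)] in_arcsD2[OF p(1)]
        by (auto dest: inj_onD)
      then show ?thesis using p by simp
    qed
    moreover have "(\<alpha> u, \<alpha> v) \<in> parcs G" if "(u, v) \<in> parcs G" for u v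
      using arc[OF that] A that by (metis imageI)
    ultimately show ?R using V inj by (auto simp: bij_betw_def)
  next
    assume R: ?R
    define h where "h = \<lparr> iso_verts = \<alpha>, iso_arcs = map_prod \<alpha> \<alpha>,
      iso_head = (snd :: 'a \<times> 'a \<Rightarrow> 'a), iso_tail = fst \<rparr>"
    have inj: "inj_on \<alpha> (pverts G)" and V: "\<alpha> ` pverts G = pverts G"
      using R by (auto simp: bij_betw_def)
    have sub: "parcs G \<subseteq> pverts G \<times> pverts G" using in_arcsD1 in_arcsD2 by auto
    have "map_prod \<alpha> \<alpha> ` parcs G = parcs G"
    proof (intro equalityI subsetI)
      fix e assume "e \<in> map_prod \<alpha> \<alpha> ` parcs G"
      then show "e \<in> parcs G" using R sub by auto
    next
      fix e assume e: "e \<in> parcs G"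
      then have "fst e \<in> \<alpha> ` pverts G" "snd e \<in> \<alpha> ` pverts G" using V sub by auto
      then obtain u v where uv: "u \<in> pverts G" "v \<in> pverts G" "e = (\<alpha> u, \<alpha> v)"
        by (metis imageE prod.collapse)
      then have "(u, v) \<in> parcs G" using R e by blast
      then show "e \<in> map_prod \<alpha> \<alpha> ` parcs G" using uv by force
    qed
    moreover have "inj_on (map_prod \<alpha> \<alpha>) (parcs G)"
      using map_prod_inj_on[OF inj inj] sub by (rule inj_on_subset)
    ultimately show ?L unfolding graph_automorphism_def
      using inj V wf
      by (intro exI[of _ h])
        (auto simp: pre_digraph.digraph_isomorphism_def app_iso_def h_def with_proj_def)
  }
qed

lemma hypercube_arcs_sym:
  assumes "(x, y) \<in> parcs (hypercube n)"
  shows "(y, x) \<in> parcs (hypercube n)"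
proof -
  have "length x = n \<and> length y = n \<and> (\<exists>!i. i < n \<and> x ! i \<noteq> y ! i)"
    using assms unfolding hypercube_def pair_pre_digraph.simps mem_Collect_eq prod.case .
  moreover have "(\<lambda>i. i < n \<and> x ! i \<noteq> y ! i) = (\<lambda>i. i < n \<and> y ! i \<noteq> x ! i)"
    by (intro ext) (simp only: eq_commute)
  ultimately show ?thesis
    unfolding hypercube_def pair_pre_digraph.simps mem_Collect_eq prod.case by (simp only: simp_thms)
qed

lemma pair_graph_folded_hypercube:
  assumes "n \<ge> 1"
  shows "pair_graph (folded_hypercube n)"
proof -
  have fin: "finite {x :: bool list. length x = n}"
    using finite_lists_length_eq[of "UNIV :: bool set" n] by simp
  have sub: "parcs (folded_hypercube n) \<subseteq> {x. length x = n} \<times> {x. length x = n}"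
    by (auto simp: folded_hypercube_def hypercube_def)
  have loop: "map Not x \<noteq> x" if "length x = n" for x
    using that assms by (cases x) auto
  have sym: "sym (parcs (folded_hypercube n))"
  proof (rule symI)
    fix x y assume "(x, y) \<in> parcs (folded_hypercube n)"
    then consider "(x, y) \<in> parcs (hypercube n)" | "length x = n" "y = map Not x"
      by (auto simp: folded_hypercube_def hypercube_def)
    then show "(y, x) \<in> parcs (folded_hypercube n)"
    proof cases
      case 1
      then have "(y, x) \<in> parcs (hypercube n)" by (rule hypercube_arcs_sym)
      then show ?thesis by (simp add: folded_hypercube_def)
    next
      case 2
      then have "(y, x) = (y, map Not y)" "y \<in> pverts (hypercube n)"
        by (simp_all add: comp_def hypercube_def)
      then show ?thesis unfolding folded_hypercube_def by auto
    qed
  qed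
  have wf: "fst e \<in> pverts (folded_hypercube n)" "snd e \<in> pverts (folded_hypercube n)"
    if "e \<in> parcs (folded_hypercube n)" for e
    using sub that by (auto simp: folded_hypercube_def hypercube_def)
  have ne: "fst e \<noteq> snd e" if "e \<in> parcs (folded_hypercube n)" for e
  proof (cases "e \<in> parcs (hypercube n)")
    case True
    then have "\<exists>i. fst e ! i \<noteq> snd e ! i"
      unfolding hypercube_def pair_pre_digraph.simps mem_Collect_eq case_prod_beta by blast
    then show ?thesis by metis
  next
    case False
    then have "e \<in> {(x, map Not x) | x. x \<in> pverts (hypercube n)}"
      using that unfolding folded_hypercube_def pair_pre_digraph.simps by blast
    then obtain x where "e = (x, map Not x)" "length x = n"
      by (auto simp: hypercube_def)
    then show ?thesis using loop[of x] by simp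
  qed
  have finv: "finite (pverts (folded_hypercube n))"
    using fin by (simp add: folded_hypercube_def hypercube_def)
  have fina: "finite (parcs (folded_hypercube n))"
    using finite_subset[OF sub] fin by simp
  show ?thesis
    by unfold_locales (use wf ne finv fina sym in \<open>auto simp: symmetric_def\<close>)
qed

end

theory Submission
  imports Defs
begin

text \<open>
  Adjacency in \<open>FQ\<^sub>n\<close> depends only on the set of coordinates in which two vertices differ:
  this set must be a singleton or the whole of \<open>{0..<n}\<close>. In other words \<open>FQ\<^sub>n\<close> is the Cayley graph
  of \<open>(\<int>/2)\<^sup>n\<close> for the connection set formed by the unit vectors and the all-ones
  vector \<open>1\<close>. Two kinds of automorphism suffice to move every arc \<open>(u, v)\<close> to the arc \<open>(0, 1)\<close>,
  and then, by composing with inverses, to every other arc.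

  Translations by \<open>u\<close> leave difference sets unchanged, and they bring the tail of the arc to \<open>0\<close>.
  The head is then \<open>1\<close> or a unit vector \<open>e\<^sub>i\<close>. In the second case the shear that adds coordinate
  \<open>i\<close> to all the other coordinates is applied. It is linear, it exchanges \<open>e\<^sub>i\<close> and \<open>1\<close>, and it fixes all
  other unit vectors; hence it preserves the connection set (lemma \<open>shear_parcs\<close>).
\<close>

lemma graph_automorphism_comp:
  assumes "pair_wf_digraph G" "graph_automorphism (with_proj G) \<alpha>"
    "graph_automorphism (with_proj G) \<beta>"
  shows "graph_automorphism (with_proj G) (\<beta> \<circ> \<alpha>)"
proof -
  have \<alpha>: "bij_betw \<alpha> (pverts G) (pverts G)"
    "\<And>u v. u \<in> pverts G \<Longrightarrow> v \<in> pverts G \<Longrightarrow> (u, v) \<in> parcs G \<longleftrightarrow> (\<alpha> u, \<alpha> v) \<in> parcs G"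
    using assms(2) unfolding graph_automorphism_with_proj[OF assms(1)] by blast+
  have \<beta>: "bij_betw \<beta> (pverts G) (pverts G)"
    "\<And>u v. u \<in> pverts G \<Longrightarrow> v \<in> pverts G \<Longrightarrow> (u, v) \<in> parcs G \<longleftrightarrow> (\<beta> u, \<beta> v) \<in> parcs G"
    using assms(3) unfolding graph_automorphism_with_proj[OF assms(1)] by blast+
  have "(u, v) \<in> parcs G \<longleftrightarrow> ((\<beta> \<circ> \<alpha>) u, (\<beta> \<circ> \<alpha>) v) \<in> parcs G"
    if "u \<in> pverts G" "v \<in> pverts G" for u v
    unfolding comp_apply \<alpha>(2)[OF that]
    using that by (intro \<beta>(2) bij_betw_apply[OF \<alpha>(1)])
  then show ?thesis
    unfolding graph_automorphism_with_proj[OF assms(1)]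
    using bij_betw_trans[OF \<alpha>(1) \<beta>(1)] by blast
qed

lemma graph_automorphism_the_inv_into:
  assumes "pair_wf_digraph G" "graph_automorphism (with_proj G) \<alpha>"
  shows "graph_automorphism (with_proj G) (the_inv_into (pverts G) \<alpha>)"
proof -
  have bij: "bij_betw \<alpha> (pverts G) (pverts G)"
    and arcs: "\<forall>u\<in>pverts G. \<forall>v\<in>pverts G. (u, v) \<in> parcs G \<longleftrightarrow> (\<alpha> u, \<alpha> v) \<in> parcs G"
    using assms(2) unfolding graph_automorphism_with_proj[OF assms(1)] by blast+
  let ?\<beta> = "the_inv_into (pverts G) \<alpha>"
  have bij': "bij_betw ?\<beta> (pverts G) (pverts G)"
    using bij by (rule bij_betw_the_inv_into)
  have "(u, v) \<in> parcs G \<longleftrightarrow> (?\<beta> u, ?\<beta> v) \<in> parcs G"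
    if "u \<in> pverts G" "v \<in> pverts G" for u v
  proof -
    have "?\<beta> u \<in> pverts G" "?\<beta> v \<in> pverts G"
      using bij' that by (auto simp: bij_betw_apply)
    moreover have "\<alpha> (?\<beta> u) = u" "\<alpha> (?\<beta> v) = v"
      using f_the_inv_into_f_bij_betw[OF bij] that by auto
    ultimately show ?thesis using arcs by metis
  qed
  then show ?thesis
    using bij' assms(1) by (simp add: graph_automorphism_with_proj)
qed

text \<open>
  For an involution the backward implication on arcs is the forward one applied to the images.
\<close>
lemma graph_automorphism_involution:
  assumes "pair_wf_digraph G"
    and closed: "\<And>w. w \<in> pverts G \<Longrightarrow> f w \<in> pverts G"
    and invol: "\<And>w. w \<in> pverts G \<Longrightarrow> f (f w) = w"
    and arcs: "\<And>w z. (w, z) \<in> parcs G \<Longrightarrow> (f w, f z) \<in> parcs G"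
  shows "graph_automorphism (with_proj G) f"
proof -
  have "bij_betw f (pverts G) (pverts G)"
    by (rule bij_betw_byWitness[where f' = f]) (use closed invol in auto)
  moreover have "(u, v) \<in> parcs G \<longleftrightarrow> (f u, f v) \<in> parcs G"
    if "u \<in> pverts G" "v \<in> pverts G" for u v
    using arcs[of u v] arcs[of "f u" "f v"] invol that by auto
  ultimately show ?thesis
    using assms(1) by (simp add: graph_automorphism_with_proj)
qed

text \<open>
  Transitivity on arcs can be tested against one base pair \<open>(a, b)\<close>: to move one arc to another,
  go to the base pair and come back along an inverse.
\<close>
lemma symmetric_graph_if_base_arc:
  assumes wf: "pair_wf_digraph G"
    and base: "\<And>u v. (u, v) \<in> parcs G \<Longrightarrow>
      \<exists>\<alpha>. graph_automorphism (with_proj G) \<alpha> \<and> \<alpha> u = a \<and> \<alpha> v = b"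
  shows "symmetric_graph (with_proj G)"
  unfolding symmetric_graph_def
proof (intro ballI impI)
  fix u v x y
  assume vs: "x \<in> verts (with_proj G)" "y \<in> verts (with_proj G)"
    and "(u, v) \<in> arcs_ends (with_proj G)" "(x, y) \<in> arcs_ends (with_proj G)"
  then have "(u, v) \<in> parcs G" "(x, y) \<in> parcs G"
    by (auto simp: arcs_ends_def arc_to_ends_def)
  then obtain \<alpha> \<beta> where \<alpha>: "graph_automorphism (with_proj G) \<alpha>" "\<alpha> u = a" "\<alpha> v = b"
    and \<beta>: "graph_automorphism (with_proj G) \<beta>" "\<beta> x = a" "\<beta> y = b"
    using base by meson
  let ?\<gamma> = "the_inv_into (pverts G) \<beta>"
  have inj: "inj_on \<beta> (pverts G)"
    using \<beta>(1) wf by (simp add: graph_automorphism_with_proj bij_betw_def)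
  have "?\<gamma> a = x" "?\<gamma> b = y"
    using the_inv_into_f_f[OF inj] \<beta>(2,3) vs by auto
  moreover have "graph_automorphism (with_proj G) (?\<gamma> \<circ> \<alpha>)"
    using graph_automorphism_comp[OF wf \<alpha>(1) graph_automorphism_the_inv_into[OF wf \<beta>(1)]] .
  ultimately show "\<exists>\<delta>. graph_automorphism (with_proj G) \<delta> \<and> \<delta> u = x \<and> \<delta> v = y"
    using \<alpha>(2,3) by (intro exI[of _ "?\<gamma> \<circ> \<alpha>"]) simp
qed

lemma pverts_folded_hypercube [simp]: "pverts (folded_hypercube n) = {x. length x = n}"
  by (simp add: folded_hypercube_def hypercube_def)

text \<open>
  The union of the two edge sets becomes a condition on the difference set of the end vertices
  alone, so that a map can be checked against all edges at once.
\<close>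
lemma parcs_folded_hypercube_iff:
  "(x, y) \<in> parcs (folded_hypercube n) \<longleftrightarrow> length x = n \<and> length y = n \<and>
     ((\<exists>!i. i < n \<and> x ! i \<noteq> y ! i) \<or> (\<forall>i<n. x ! i \<noteq> y ! i))"
proof -
  have "y = map Not x \<longleftrightarrow> length y = n \<and> (\<forall>i<n. x ! i \<noteq> y ! i)" if "length x = n"
    using that by (auto simp: list_eq_iff_nth_eq)
  then show ?thesis
    unfolding folded_hypercube_def hypercube_def by auto
qed

definition translate :: "bool list \<Rightarrow> bool list \<Rightarrow> bool list" where
  "translate u w = map (\<lambda>k. w ! k \<noteq> u ! k) [0..<length w]"

text \<open>Over \<open>\<int>/2\<close>, addition is \<open>(\<noteq>)\<close>, so this is \<open>w + w\<^sub>i (1 + e\<^sub>i)\<close>.\<close>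
definition shear :: "nat \<Rightarrow> bool list \<Rightarrow> bool list" where
  "shear i w = map (\<lambda>k. w ! k \<noteq> (w ! i \<and> k \<noteq> i)) [0..<length w]"

lemma length_translate [simp]: "length (translate u w) = length w"
  by (simp add: translate_def)

lemma nth_translate [simp]: "k < length w \<Longrightarrow> translate u w ! k \<longleftrightarrow> w ! k \<noteq> u ! k"
  by (simp add: translate_def)

lemma length_shear [simp]: "length (shear i w) = length w"
  by (simp add: shear_def)

lemma nth_shear [simp]: "k < length w \<Longrightarrow> shear i w ! k \<longleftrightarrow> w ! k \<noteq> (w ! i \<and> k \<noteq> i)"
  by (simp add: shear_def)

lemma translate_automorphism:
  assumes "pair_wf_digraph (folded_hypercube n)"
  shows "graph_automorphism (with_proj (folded_hypercube n)) (translate u)"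
proof (rule graph_automorphism_involution[OF assms])
  fix w z
  assume wz: "(w, z) \<in> parcs (folded_hypercube n)"
  then have "(k < n \<and> translate u w ! k \<noteq> translate u z ! k) \<longleftrightarrow> (k < n \<and> w ! k \<noteq> z ! k)" for k
    by (auto simp: parcs_folded_hypercube_iff)
  then show "(translate u w, translate u z) \<in> parcs (folded_hypercube n)"
    using wz unfolding parcs_folded_hypercube_iff length_translate by metis
qed (auto intro: nth_equalityI)

text \<open>
  If \<open>w\<close> and \<open>z\<close> agree at \<open>i\<close>, the shear adds the same vector to both and keeps their difference set.
  If they differ at \<open>i\<close>, it complements their difference set away from \<open>i\<close>; being \<open>{i}\<close> or everything,
  the set is turned into the other of these two.
\<close>
lemma shear_parcs:
  assumes "i < n" and wz: "(w, z) \<in> parcs (folded_hypercube n)"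
  shows "(shear i w, shear i z) \<in> parcs (folded_hypercube n)"
proof (cases "w ! i = z ! i")
  case True
  then have "(k < n \<and> shear i w ! k \<noteq> shear i z ! k) \<longleftrightarrow> (k < n \<and> w ! k \<noteq> z ! k)" for k
    using wz by (auto simp: parcs_folded_hypercube_iff)
  then show ?thesis
    using wz unfolding parcs_folded_hypercube_iff length_shear by metis
next
  case False
  then have diff: "shear i w ! k \<noteq> shear i z ! k \<longleftrightarrow> k = i \<or> w ! k = z ! k" if "k < n" for k
    using that wz by (auto simp: parcs_folded_hypercube_iff)
  from wz consider "\<exists>!k. k < n \<and> w ! k \<noteq> z ! k" | "\<forall>k<n. w ! k \<noteq> z ! k"
    by (auto simp: parcs_folded_hypercube_iff)
  then show ?thesis
  proof cases
    case 1
    then have "\<forall>k<n. shear i w ! k \<noteq> shear i z ! k"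
      using diff False \<open>i < n\<close> by metis
    then show ?thesis using wz by (simp only: parcs_folded_hypercube_iff length_shear) blast
  next
    case 2
    then have "\<exists>!k. k < n \<and> shear i w ! k \<noteq> shear i z ! k"
      using diff \<open>i < n\<close> by (intro ex1I[of _ i]) blast+
    then show ?thesis using wz by (simp only: parcs_folded_hypercube_iff length_shear) blast
  qed
qed

lemma shear_automorphism:
  assumes "pair_wf_digraph (folded_hypercube n)" "i < n"
  shows "graph_automorphism (with_proj (folded_hypercube n)) (shear i)"
  by (rule graph_automorphism_involution[OF assms(1)])
    (use assms(2) in \<open>auto intro: nth_equalityI shear_parcs\<close>)

theorem theorem2p5:
  fixes n :: nat
  assumes "n \<ge> 2"
  shows "symmetric_graph (with_proj (folded_hypercube n))"
proof (rule symmetric_graph_if_base_arc)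
  interpret pair_graph "folded_hypercube n"
    using assms by (intro pair_graph_folded_hypercube) simp
  show wf: "pair_wf_digraph (folded_hypercube n)" by unfold_locales
  fix u v
  assume uv: "(u, v) \<in> parcs (folded_hypercube n)"
  then have len: "length u = n" "length v = n" by (auto simp: parcs_folded_hypercube_iff)
  have u0: "translate u u = replicate n False"
    using len by (auto intro: nth_equalityI)
  show "\<exists>\<alpha>. graph_automorphism (with_proj (folded_hypercube n)) \<alpha> \<and>
      \<alpha> u = replicate n False \<and> \<alpha> v = replicate n True"
  proof (cases "\<forall>k<n. u ! k \<noteq> v ! k")
    case True
    then have "translate u v = replicate n True"
      using len by (auto intro: nth_equalityI)
    then show ?thesis using u0 translate_automorphism[OF wf] by blast
  next
    case False
    then obtain i where i: "i < n" "\<And>k. k < n \<Longrightarrow> u ! k \<noteq> v ! k \<longleftrightarrow> k = i"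
      using uv unfolding parcs_folded_hypercube_iff by metis
    have "shear i (replicate n False) = replicate n False"
      using i(1) by (auto intro: nth_equalityI)
    then have "(shear i \<circ> translate u) u = replicate n False" using u0 by simp
    moreover have "(shear i \<circ> translate u) v = replicate n True"
      using i len by (intro nth_equalityI) auto
    ultimately show ?thesis
      using graph_automorphism_comp[OF wf translate_automorphism[OF wf]
          shear_automorphism[OF wf i(1)]] by blast
  qed
qed

end
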